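(* Let $X = \bigcup_{n=1}^N R^X_n$ and $B = \bigcup_{m=1}^M R^B_m$ (with $M \geq 1$) be two binary images in $\mathbb{Z}^2$ given in compact run-length representation, with $R^X_n = \langle lx_n, rx_n, y_n\rangle$ and $R^B_m = \langle lx^B_m, rx^B_m, y^B_m\rangle$. Let $L^B_{\max} := \max_{m \in \{1,\ldots,M\}} |R^B_m|$ and $X_{\mathrm{cut}} := \bigcup_{n=1}^N \tilde R^X_n$, where for all $n = 1,\ldots,N$ $$\tilde R^X_n := \begin{cases} \langle lx_n + (L^B_{\max} - 1),\, rx_n,\, y_n\rangle & \text{if } L^B_{\max} \leq |R^X_n|, \\ \emptyset & \text{else.}\end{cases}$$ Let $R^B_{\hat m}$ be any run of $B$ (with $\hat m \in \{1,\ldots,M\}$) such that $|R^B_{\hat m}| = L^B_{\max}$, and let $q := (rx^B_{\hat m}, y^B_{\hat m})$ be the rightmost pixel of $R^B_{\hat m}$. Then $$\varepsilon_B(X) = \left[\varepsilon_{B_{-q}}(X)\right]_{-q} = \big\{p \in X_{\mathrm{cut}} \mid B_{p-q} \subseteq X_{L_{\min}}\big\}_{-q},$$ where $L_{\min} := \min_{m \in \{1,\ldots,M\}} |R^B_m|$ and $X_{L_{\min}} := \bigcup_{1 \leq n \leq N,\ |R^X_n| \geq L_{\min}} R^X_n$.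
   Context: A binary image is a set of pixels, i.e. a subset of $\mathbb{Z}^2$. For $B \subseteq \mathbb{Z}^2$ and $p \in \mathbb{Z}^2$, $B_p := \{b + p \mid b \in B\}$ is the translate of $B$ by $p$ (the same subscript notation is used for translating any set, e.g. $[\,\cdot\,]_{-q}$ is translation by $-q$). The erosion of $X \subseteq \mathbb{Z}^2$ by $B \subseteq \mathbb{Z}^2$ is $\varepsilon_B(X) := \{p \in \mathbb{Z}^2 \mid B_p \subseteq X\}$. A run is a nonempty horizontal segment of pixels $\langle lx, rx, y\rangle := \{(lx,y),(lx+1,y),\ldots,(rx,y)\}$ with integers $lx \leq rx$ and $y$; $|R|$ denotes the number of pixels of a run $R$. A run-length representation of a (finite) image $Z \subseteq \mathbb{Z}^2$ is a finite family of runs $R_1,\ldots,R_N$ with $Z = \bigcup_{n=1}^N R_n$. It is compact if horizontally contiguous pixels always form a single run (are not divided into several runs) and runs do not overlap; i.e. the runs are exactly the distinct maximal horizontal segments of $Z$. *)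

theory Defs
  imports Main "HOL-Library.Product_Plus"
begin

type_synonym pixel = "int \<times> int"

definition translate :: "pixel set \<Rightarrow> pixel \<Rightarrow> pixel set" where
  "translate B p = (\<lambda>b. b + p) ` B"

definition erosion :: "pixel set \<Rightarrow> pixel set \<Rightarrow> pixel set" where
  "erosion B X = {p. translate B p \<subseteq> X}"

datatype run = Run (left_x: int) (right_x: int) (row: int)

definition pixels :: "run \<Rightarrow> pixel set" where
  "pixels R = {left_x R..right_x R} \<times> {row R}"

definition run_length :: "run \<Rightarrow> nat" where
  "run_length R = card (pixels R)"

definition rightmost_pixel :: "run \<Rightarrow> pixel" where
  "rightmost_pixel R = (right_x R, row R)"

text \<open>Families of runs are indexed by \<open>{1..N}\<close>; the empty family (\<open>N = 0\<close>) represents the empty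
  image. The datatype does not force a run to be nonempty, so this is part of being a
  representation.\<close>

definition rl_representation :: "pixel set \<Rightarrow> nat \<Rightarrow> (nat \<Rightarrow> run) \<Rightarrow> bool" where
  "rl_representation Z N R \<longleftrightarrow>
     (\<forall>n\<in>{1..N}. left_x (R n) \<le> right_x (R n)) \<and> Z = (\<Union>n\<in>{1..N}. pixels (R n))"

text \<open>Distinct indices carry disjoint runs, and every horizontal segment of the image lies inside
  a single run. Hence the runs are the maximal horizontal segments, each listed once.\<close>

definition compact_rl_representation :: "pixel set \<Rightarrow> nat \<Rightarrow> (nat \<Rightarrow> run) \<Rightarrow> bool" where
  "compact_rl_representation Z N R \<longleftrightarrow>
     rl_representation Z N R \<and>
     (\<forall>m\<in>{1..N}. \<forall>n\<in>{1..N}. m \<noteq> n \<longrightarrow> pixels (R m) \<inter> pixels (R n) = {}) \<and>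
     (\<forall>a b y. a \<le> b \<and> pixels (Run a b y) \<subseteq> Z \<longrightarrow> (\<exists>n\<in>{1..N}. pixels (Run a b y) \<subseteq> pixels (R n)))"

text \<open>Both extrema are meant for a nonempty family, \<open>M \<ge> 1\<close>.\<close>

definition max_run_length :: "nat \<Rightarrow> (nat \<Rightarrow> run) \<Rightarrow> nat" where
  "max_run_length M R = Max ((\<lambda>m. run_length (R m)) ` {1..M})"

definition min_run_length :: "nat \<Rightarrow> (nat \<Rightarrow> run) \<Rightarrow> nat" where
  "min_run_length M R = Min ((\<lambda>m. run_length (R m)) ` {1..M})"

definition cut_run :: "nat \<Rightarrow> run \<Rightarrow> pixel set" where
  "cut_run L R =
     (if L \<le> run_length R then pixels (Run (left_x R + (int L - 1)) (right_x R) (row R)) else {})"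

definition cut_image :: "nat \<Rightarrow> nat \<Rightarrow> (nat \<Rightarrow> run) \<Rightarrow> pixel set" where
  "cut_image L N R = (\<Union>n\<in>{1..N}. cut_run L (R n))"

definition long_runs_image :: "nat \<Rightarrow> nat \<Rightarrow> (nat \<Rightarrow> run) \<Rightarrow> pixel set" where
  "long_runs_image L N R = (\<Union>n\<in>{n\<in>{1..N}. L \<le> run_length (R n)}. pixels (R n))"

end

theory Submission
  imports Defs
begin

text \<open>A translate of a run of \<open>B\<close> that fits into \<open>X\<close> lies, by compactness, inside a single run of
  \<open>X\<close>, which is therefore at least as long. So only runs of length at least \<open>L\<^sub>m\<^sub>i\<^sub>n\<close> matter. With the
  origin of \<open>B\<close> moved to the right end \<open>q\<close> of a longest run, the fit of that run alone forces the
  position \<open>p\<close> into the part of a run of \<open>X\<close> that survives cutting \<open>L\<^sub>m\<^sub>a\<^sub>x - 1\<close> pixels on the left.\<close>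

lemma translate_translate: "translate (translate A p) q = translate A (p + q)"
  by (simp add: translate_def image_image add.assoc)

lemma mem_translate_iff: "x \<in> translate A p \<longleftrightarrow> x - p \<in> A"
  by (force simp: translate_def)

lemma translate_pixels:
  "translate (pixels R) (u, v) = pixels (Run (left_x R + u) (right_x R + u) (row R + v))"
  by (auto simp: mem_translate_iff pixels_def)

lemma erosion_translate: "erosion (translate B (- q)) X = {p. translate B (p - q) \<subseteq> X}"
  by (simp add: erosion_def translate_translate)

text \<open>Membership of \<open>p\<close> on the right tests \<open>p + q\<close> against
  \<open>{p. translate B (p - q) \<subseteq> X}\<close>, and there the two shifts by
  \<open>q\<close> cancel.\<close>

lemma erosion_eq_translate_erosion_translate:
  "erosion B X = translate (erosion (translate B (- q)) X) (- q)"
proof (intro set_eqI)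
  fix p show "p \<in> erosion B X \<longleftrightarrow> p \<in> translate (erosion (translate B (- q)) X) (- q)"
    by (simp only: mem_translate_iff erosion_translate) (simp add: erosion_def)
qed

lemma run_length_eq: "run_length R = nat (right_x R - left_x R + 1)"
  by (simp add: run_length_def pixels_def card_cartesian_product)

text \<open>An empty segment lies in every run; only for \<open>a \<le> b\<close> does containment
  determine the position of the endpoints.\<close>

lemma pixels_Run_subset_iff:
  assumes "a \<le> b"
  shows "pixels (Run a b y) \<subseteq> pixels R \<longleftrightarrow> left_x R \<le> a \<and> b \<le> right_x R \<and> y = row R"
  using assms by (auto simp: pixels_def times_subset_iff)

lemma long_runs_image_subset:
  "rl_representation X N R \<Longrightarrow> long_runs_image L N R \<subseteq> X"
  by (auto simp: rl_representation_def long_runs_image_def)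

text \<open>Stating containment through endpoints reduces both later uses, comparing lengths and
  locating the cut, to linear arithmetic.\<close>

lemma translated_run_in_run:
  assumes X: "compact_rl_representation X N R"
    and S: "left_x S \<le> right_x S" "translate (pixels S) (u, v) \<subseteq> X"
  obtains n where "n \<in> {1..N}" "left_x (R n) \<le> left_x S + u" "right_x S + u \<le> right_x (R n)"
    "row (R n) = row S + v"
proof -
  have "pixels (Run (left_x S + u) (right_x S + u) (row S + v)) \<subseteq> X"
    using S(2) by (simp add: translate_pixels)
  then obtain n where "n \<in> {1..N}"
      "pixels (Run (left_x S + u) (right_x S + u) (row S + v)) \<subseteq> pixels (R n)"
    \<comment> \<open>The maximality clause of compactness applies because shifting both ends by
      \<open>u\<close> keeps the segment nonempty.\<close>
    using X S(1) unfolding compact_rl_representation_def by (meson add_le_cancel_right)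
  then show thesis
    using S(1) by (intro that) (auto simp: pixels_Run_subset_iff)
qed

lemma translated_run_subset_long_runs_image:
  assumes X: "compact_rl_representation X N R"
    and S: "left_x S \<le> right_x S" "translate (pixels S) t \<subseteq> X" "L \<le> run_length S"
  shows "translate (pixels S) t \<subseteq> long_runs_image L N R"
proof -
  obtain u v where t: "t = (u, v)" by (cases t)
  then obtain n where n: "n \<in> {1..N}" "left_x (R n) \<le> left_x S + u"
      "right_x S + u \<le> right_x (R n)" "row (R n) = row S + v"
    using translated_run_in_run[OF X S(1)] S(2) by blast
  \<comment> \<open>\<open>R n\<close> contains a shifted copy of \<open>S\<close>, so it is at
    least as long and survives the length filter.\<close>
  have "L \<le> run_length (R n)"
    using n S(3) by (simp add: run_length_eq)
  moreover have "translate (pixels S) t \<subseteq> pixels (R n)"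
    using n S(1) by (simp add: t translate_pixels pixels_Run_subset_iff)
  ultimately show ?thesis
    using n(1) by (auto simp: long_runs_image_def)
qed

lemma position_in_cut_image:
  assumes X: "compact_rl_representation X N R"
    and S: "left_x S \<le> right_x S" "translate (pixels S) (p - rightmost_pixel S) \<subseteq> X"
  shows "p \<in> cut_image (run_length S) N R"
proof -
  obtain px py where p: "p = (px, py)" by (cases p)
  have "translate (pixels S) (px - right_x S, py - row S) \<subseteq> X"
    using S(2) by (simp add: p rightmost_pixel_def)
  then obtain n where n: "n \<in> {1..N}" "left_x (R n) \<le> left_x S + (px - right_x S)"
      "right_x S + (px - right_x S) \<le> right_x (R n)" "row (R n) = row S + (py - row S)"
    using translated_run_in_run[OF X S(1)] by blast
  \<comment> \<open>The shift puts the right end of \<open>S\<close> at \<open>p\<close>, hence its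
    left end at \<open>px - (run_length S - 1)\<close>. As this is at least
    \<open>left_x (R n)\<close>, \<open>p\<close> lies to the right of the removed pixels.\<close>
  have "p \<in> cut_run (run_length S) (R n)"
    using n S(1) by (auto simp: cut_run_def p pixels_def run_length_eq)
  with n(1) show ?thesis
    by (auto simp: cut_image_def)
qed

theorem theorem10:
  fixes X B :: "pixel set" and N M mhat :: nat and RX RB :: "nat \<Rightarrow> run" and q :: pixel
  assumes "compact_rl_representation X N RX"
    and "compact_rl_representation B M RB"
    and "M \<ge> 1"
    and "mhat \<in> {1..M}"
    and "run_length (RB mhat) = max_run_length M RB"
    and "q = rightmost_pixel (RB mhat)"
  shows "erosion B X = translate (erosion (translate B (- q)) X) (- q) \<and>
    translate (erosion (translate B (- q)) X) (- q) =
      translate {p \<in> cut_image (max_run_length M RB) N RX.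
        translate B (p - q) \<subseteq> long_runs_image (min_run_length M RB) N RX} (- q)"
proof -
  have B: "B = (\<Union>m\<in>{1..M}. pixels (RB m))"
    and RB: "\<And>m. m \<in> {1..M} \<Longrightarrow> left_x (RB m) \<le> right_x (RB m)"
    using assms(2) by (auto simp: compact_rl_representation_def rl_representation_def)
  have translate_B: "translate B t = (\<Union>m\<in>{1..M}. translate (pixels (RB m)) t)" for t
    by (simp add: B translate_def image_UN)
  have "p \<in> cut_image (max_run_length M RB) N RX \<and>
      translate B (p - q) \<subseteq> long_runs_image (min_run_length M RB) N RX"
    if p: "translate B (p - q) \<subseteq> X" for p
  proof
    have fits: "translate (pixels (RB m)) (p - q) \<subseteq> X" if "m \<in> {1..M}" for m
      using p that unfolding translate_B by blast
    \<comment> \<open>The run \<open>RB mhat\<close> alone decides this: \<open>q\<close> is its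
      right end and its length is the maximum.\<close>
    show "p \<in> cut_image (max_run_length M RB) N RX"
      using position_in_cut_image[OF assms(1) RB[OF assms(4)]] fits[OF assms(4)] assms(5,6)
      by simp
    have "min_run_length M RB \<le> run_length (RB m)" if "m \<in> {1..M}" for m
      using that by (auto simp: min_run_length_def intro: Min_le)
    then show "translate B (p - q) \<subseteq> long_runs_image (min_run_length M RB) N RX"
      unfolding translate_B
      by (intro UN_least translated_run_subset_long_runs_image[OF assms(1)] RB fits)
  qed
  \<comment> \<open>This gives the converse inclusion: a translate of \<open>B\<close> that fits
    into the long runs fits into \<open>X\<close>.\<close>
  moreover have "long_runs_image (min_run_length M RB) N RX \<subseteq> X"
    using assms(1) by (intro long_runs_image_subset) (simp add: compact_rl_representation_def)
  ultimately have "erosion (translate B (- q)) X = {p \<in> cut_image (max_run_length M RB) N RX.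
      translate B (p - q) \<subseteq> long_runs_image (min_run_length M RB) N RX}"
    unfolding erosion_translate by blast
  then show ?thesis
    using erosion_eq_translate_erosion_translate[of B X q] by simp
qed

end
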